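(* Let $x,y,u$ be formal variables. In $\mathcal{A}[[x,y,u]]$, we have $$1+\sum_{k\ge r\ge1}\sum_{h=0}^{r}S(k,r,h)\,x^{k-r}y^ru^h=\exp\left\{\sum_{n\ge1}\frac{\zeta_{\mathcal{A}}^{(2)}(n)}{n}\left(x^n-\alpha^n-\beta^n\right)\right\},$$ where $\alpha$ and $\beta$ are formally determined by $$\alpha+\beta=x-y,\qquad \alpha\beta=-xy(1-u).$$
   Context: Let $\mathcal{P}$ be the set of prime numbers and $\mathcal{A}=\prod_{p\in\mathcal{P}}\mathbb{Z}/p\mathbb{Z}\big/\bigoplus_{p\in\mathcal{P}}\mathbb{Z}/p\mathbb{Z}$, which is a $\mathbb{Q}$-algebra. For a finite sequence (index) of positive integers $\boldsymbol{k}=(k_1,\ldots,k_r)$, the level-two finite multiple zeta value is $$\zeta_{\mathcal{A}}^{(2)}(k_1,\ldots,k_r)=\left(\sum_{0<n_1<\cdots<n_r<p/2}\frac{1}{n_1^{k_1}\cdots n_r^{k_r}}\bmod p\right)_{p}\in\mathcal{A}.$$ The weight of $\boldsymbol{k}$ is $k_1+\cdots+k_r$, its depth is $r$, and its height is the number of $j$ with $k_j\ge2$. For integers $k\ge r\ge1$ and $0\le h\le r$, let $I(k,r,h)$ be the set of indices of weight $k$, depth $r$ and height $h$, and $$S(k,r,h)=\sum_{\boldsymbol{k}\in I(k,r,h)}\zeta_{\mathcal{A}}^{(2)}(\boldsymbol{k})$$ (zero if $I(k,r,h)$ is empty). Only the symmetric combinations $\alpha^n+\beta^n$ occur; each is understood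 as the corresponding polynomial in $\alpha+\beta$ and $\alpha\beta$, hence as a polynomial in $x,y,u$, so that the right-hand side is well defined in $\mathcal{A}[[x,y,u]]$. *)

theory Defs
  imports
    "HOL-Number_Theory.Number_Theory"
    "HOL-Computational_Algebra.Formal_Power_Series"
begin

section \<open>The ring $\mathcal A$\<close>

text \<open>
  An element of $\prod_p \mathbb{Z}/p\mathbb{Z}$ is represented by a family of integers, read modulo
  $p$ at each prime $p$; values at non-prime positions are irrelevant. Dividing out the ideal
  $\bigoplus_p \mathbb{Z}/p\mathbb{Z}$ amounts to ignoring finitely many primes. Both quotients are
  taken at once.
\<close>

definition padele_rel :: "(nat \<Rightarrow> int) \<Rightarrow> (nat \<Rightarrow> int) \<Rightarrow> bool" where
  "padele_rel f g \<longleftrightarrow> finite {p. prime p \<and> \<not> [f p = g p] (mod int p)}"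

lemma padele_rel_iff_eventually:
  "padele_rel f g \<longleftrightarrow> eventually (\<lambda>p. prime p \<longrightarrow> [f p = g p] (mod int p)) cofinite"
  unfolding padele_rel_def eventually_cofinite by (rule arg_cong[where f = finite]) auto

lemma equivp_padele_rel: "equivp padele_rel"
proof (rule equivpI)
  show "reflp padele_rel"
    by (auto simp: reflp_def padele_rel_def)
  show "symp padele_rel"
    by (auto simp: symp_def padele_rel_def cong_sym_eq)
  show "transp padele_rel"
    unfolding transp_def padele_rel_iff_eventually
  proof (intro allI impI)
    fix f g h :: "nat \<Rightarrow> int"
    assume "\<forall>\<^sub>F p in cofinite. prime p \<longrightarrow> [f p = g p] (mod int p)"
      and "\<forall>\<^sub>F p in cofinite. prime p \<longrightarrow> [g p = h p] (mod int p)"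
    thus "\<forall>\<^sub>F p in cofinite. prime p \<longrightarrow> [f p = h p] (mod int p)"
      by eventually_elim (auto intro: cong_trans)
  qed
qed

lemma padele_rel_binop:
  assumes "padele_rel f f'" "padele_rel g g'"
    and "\<And>p. [f p = f' p] (mod int p) \<Longrightarrow> [g p = g' p] (mod int p) \<Longrightarrow> [h p = h' p] (mod int p)"
  shows "padele_rel h h'"
  using assms(1,2) unfolding padele_rel_iff_eventually
  by eventually_elim (use assms(3) in auto)

quotient_type padele = "nat \<Rightarrow> int" / padele_rel
  morphisms rep_padele abs_padele
  by (rule equivp_padele_rel)

lemma modular_inverse_cong:
  fixes a b m :: int
  assumes "[a = b] (mod m)" "m > 0"
  shows "modular_inverse m a = modular_inverse m b"
proof (cases "coprime a m")
  case True
  have "coprime b m"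
    using assms True cong_imp_coprime by blast
  have "[a * modular_inverse m b = b * modular_inverse m b] (mod m)"
    by (intro cong_mult assms cong_refl)
  also have "[b * modular_inverse m b = 1] (mod m)"
    by (rule cong_modular_inverse1) fact
  finally show ?thesis
    using assms(2) modular_inverse_int_nonneg modular_inverse_int_less
    by (intro modular_inverse_int_eqI) auto
next
  case False
  hence "\<not> coprime b m"
    using assms(1) cong_imp_coprime cong_sym by blast
  with False show ?thesis by simp
qed

instantiation padele :: comm_ring_1
begin

lift_definition zero_padele :: padele is "\<lambda>_. 0" .
lift_definition one_padele :: padele is "\<lambda>_. 1" .

lift_definition plus_padele :: "padele \<Rightarrow> padele \<Rightarrow> padele" is "\<lambda>f g p. f p + g p"
  by (erule (1) padele_rel_binop) (rule cong_add)

lift_definition minus_padele :: "padele \<Rightarrow> padele \<Rightarrow> padele" is "\<lambda>f g p. f p - g p"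
  by (erule (1) padele_rel_binop) (rule cong_diff)

lift_definition uminus_padele :: "padele \<Rightarrow> padele" is "\<lambda>f p. - f p"
  unfolding padele_rel_iff_eventually by (elim eventually_mono) (auto simp: cong_minus_minus_iff)

lift_definition times_padele :: "padele \<Rightarrow> padele \<Rightarrow> padele" is "\<lambda>f g p. f p * g p"
  by (erule (1) padele_rel_binop) (rule cong_mult)

instance
proof
  have "{p. prime p \<and> \<not> [0 = 1] (mod int p)} = {p::nat. prime p}"
    by (auto simp: cong_def dest: prime_gt_1_nat)
  hence "\<not> padele_rel (\<lambda>_. 0) (\<lambda>_. 1)"
    using primes_infinite by (simp add: padele_rel_def)
  thus "(0::padele) \<noteq> 1"
    by transfer
qed (transfer; simp add: padele_rel_def algebra_simps)+

end

text \<open>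
  Componentwise inverse, with value $0$ in the components where there is none. It makes $1/n$
  available for every integer $n > 0$, i.e. the $\mathbb{Q}$-algebra structure of $\mathcal A$.
\<close>

instantiation padele :: inverse
begin

lift_definition inverse_padele :: "padele \<Rightarrow> padele" is "\<lambda>f p. modular_inverse (int p) (f p)"
proof -
  fix f g :: "nat \<Rightarrow> int"
  assume "padele_rel f g"
  thus "padele_rel (\<lambda>p. modular_inverse (int p) (f p)) (\<lambda>p. modular_inverse (int p) (g p))"
    unfolding padele_rel_iff_eventually
    by (elim eventually_mono) (auto dest!: modular_inverse_cong simp: prime_gt_0_nat)
qed

definition divide_padele :: "padele \<Rightarrow> padele \<Rightarrow> padele" where
  "divide_padele a b = a * inverse b"

instance ..

end

lemma of_nat_padele: "of_nat n = abs_padele (\<lambda>_. int n)"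
  by (induction n)
     (simp_all add: zero_padele.abs_eq one_padele.abs_eq plus_padele.abs_eq add.commute)

lemma padele_of_nat_inverse:
  assumes "n > 0"
  shows "of_nat n * inverse (of_nat n :: padele) = 1"
proof -
  have "{p. prime p \<and> \<not> [int n * modular_inverse (int p) (int n) = 1] (mod int p)} \<subseteq> {p. p dvd n}"
  proof clarsimp
    fix p :: nat
    assume p: "prime p" "\<not> [int n * modular_inverse (int p) (int n) = 1] (mod int p)"
    hence "\<not> coprime (int n) (int p)"
      using cong_modular_inverse1 by blast
    thus "p dvd n"
      using p(1) by (metis coprime_commute coprime_int_iff prime_imp_coprime)
  qed
  hence "finite {p. prime p \<and> \<not> [int n * modular_inverse (int p) (int n) = 1] (mod int p)}"
    using finite_divisors_nat[OF assms] finite_subset by blast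
  thus ?thesis
    by (simp add: of_nat_padele inverse_padele.abs_eq times_padele.abs_eq one_padele.abs_eq
        padele.abs_eq_iff padele_rel_def)
qed


section \<open>Level-two finite multiple zeta values\<close>

definition zeta2_sum :: "nat list \<Rightarrow> nat \<Rightarrow> int" where
  "zeta2_sum ks p =
     (\<Sum>ns\<in>{ns. length ns = length ks \<and> sorted_wrt (<) ns \<and> (\<forall>n\<in>set ns. 0 < n \<and> 2 * n < p)}.
        \<Prod>j<length ks. modular_inverse (int p) (int (ns ! j) ^ (ks ! j)))"

definition zeta2 :: "nat list \<Rightarrow> padele" where
  "zeta2 ks = abs_padele (zeta2_sum ks)"

definition weight :: "nat list \<Rightarrow> nat" where
  "weight ks = sum_list ks"

definition depth :: "nat list \<Rightarrow> nat" where
  "depth ks = length ks"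

definition height :: "nat list \<Rightarrow> nat" where
  "height ks = card {j. j < length ks \<and> ks ! j \<ge> 2}"

definition indices :: "nat \<Rightarrow> nat \<Rightarrow> nat \<Rightarrow> nat list set" where
  "indices k r h =
     {ks. (\<forall>m\<in>set ks. m \<ge> 1) \<and> weight ks = k \<and> depth ks = r \<and> height ks = h}"

lemma finite_indices: "finite (indices k r h)"
proof (rule finite_subset)
  show "indices k r h \<subseteq> {ks. set ks \<subseteq> {..k} \<and> length ks = r}"
    by (auto simp: indices_def weight_def depth_def intro: member_le_sum_list)
  show "finite {ks. set ks \<subseteq> {..k} \<and> length ks = r}"
    by (rule finite_lists_length_eq) auto
qed

lemma finite_zeta2_range:
  "finite {ns. length ns = r \<and> sorted_wrt (<) ns \<and> (\<forall>n\<in>set ns. 0 < n \<and> 2 * n < (p::nat))}"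
proof (rule finite_subset)
  show "{ns. length ns = r \<and> sorted_wrt (<) ns \<and> (\<forall>n\<in>set ns. 0 < n \<and> 2 * n < p)}
          \<subseteq> {ns. set ns \<subseteq> {..p} \<and> length ns = r}"
    by auto
  show "finite {ns. set ns \<subseteq> {..p} \<and> length ns = r}"
    by (rule finite_lists_length_eq) auto
qed

definition S2 :: "nat \<Rightarrow> nat \<Rightarrow> nat \<Rightarrow> padele" where
  "S2 k r h = (\<Sum>ks\<in>indices k r h. zeta2 ks)"


section \<open>Formal power series in three variables\<close>

text \<open>
  $R[[x,y,u]]$ is taken to be $R[[x]][[y]][[u]]$. The topology that the library puts on
  \<^typ>\<open>'a fps\<close> is adic in the outermost variable only, so infinite sums are defined here
  coefficientwise, for families in which every monomial occurs only finitely often.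
\<close>

type_synonym 'a fps3 = "'a fps fps fps"

definition coeff3 :: "'a::zero fps3 \<Rightarrow> nat \<Rightarrow> nat \<Rightarrow> nat \<Rightarrow> 'a" where
  "coeff3 F i j l = fps_nth (fps_nth (fps_nth F l) j) i"

definition const3 :: "'a::zero \<Rightarrow> 'a fps3" where
  "const3 c = fps_const (fps_const (fps_const c))"

definition varx :: "'a::comm_ring_1 fps3" where
  "varx = fps_const (fps_const fps_X)"

definition vary :: "'a::comm_ring_1 fps3" where
  "vary = fps_const fps_X"

definition varu :: "'a::comm_ring_1 fps3" where
  "varu = fps_X"

definition locally_finite3 :: "('i \<Rightarrow> 'a::comm_ring_1 fps3) \<Rightarrow> 'i set \<Rightarrow> bool" where
  "locally_finite3 f I \<longleftrightarrow> (\<forall>i j l. finite {s\<in>I. coeff3 (f s) i j l \<noteq> 0})"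

text \<open>Only meaningful for families satisfying \<^const>\<open>locally_finite3\<close>.\<close>

definition formal_sum3 :: "('i \<Rightarrow> 'a::comm_ring_1 fps3) \<Rightarrow> 'i set \<Rightarrow> 'a fps3" where
  "formal_sum3 f I =
     Abs_fps (\<lambda>l. Abs_fps (\<lambda>j. Abs_fps (\<lambda>i.
       \<Sum>s\<in>{s\<in>I. coeff3 (f s) i j l \<noteq> 0}. coeff3 (f s) i j l)))"

text \<open>Only meaningful for series with vanishing constant coefficient.\<close>

definition formal_exp3 :: "'a::{comm_ring_1,inverse} fps3 \<Rightarrow> 'a fps3" where
  "formal_exp3 F = formal_sum3 (\<lambda>m. const3 (1 / of_nat (fact m)) * F ^ m) (UNIV :: nat set)"

lemma coeff3_formal_sum3:
  "coeff3 (formal_sum3 f I) i j l = (\<Sum>s\<in>{s\<in>I. coeff3 (f s) i j l \<noteq> 0}. coeff3 (f s) i j l)"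
  by (simp add: coeff3_def formal_sum3_def)

lemma fps3_eqI: "(\<And>i j l. coeff3 F i j l = coeff3 G i j l) \<Longrightarrow> F = G"
  by (simp add: coeff3_def fps_eq_iff)

lemma formal_sum3_finite:
  assumes "finite I"
  shows "formal_sum3 f I = sum f I"
proof (rule fps3_eqI)
  fix i j l
  have "coeff3 (sum f I) i j l = (\<Sum>s\<in>I. coeff3 (f s) i j l)"
    by (simp add: coeff3_def fps_sum_nth)
  also have "\<dots> = coeff3 (formal_sum3 f I) i j l"
    unfolding coeff3_formal_sum3 by (rule sum.mono_neutral_right) (use assms in auto)
  finally show "coeff3 (formal_sum3 f I) i j l = coeff3 (sum f I) i j l" by simp
qed


subsection \<open>Local finiteness of the families in use\<close>

definition order_ge3 :: "nat \<Rightarrow> 'a::zero fps3 \<Rightarrow> bool" where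
  "order_ge3 d F \<longleftrightarrow> (\<forall>i j l. i + j + l < d \<longrightarrow> coeff3 F i j l = 0)"

lemma order_ge3_0 [simp]: "order_ge3 0 F"
  by (simp add: order_ge3_def)

lemma order_ge3_mono: "order_ge3 d F \<Longrightarrow> d' \<le> d \<Longrightarrow> order_ge3 d' F"
  by (simp add: order_ge3_def)

lemma order_ge3_diff: "order_ge3 d F \<Longrightarrow> order_ge3 d G \<Longrightarrow> order_ge3 d (F - G :: 'a::comm_ring_1 fps3)"
  by (simp add: order_ge3_def coeff3_def)

lemma order_ge3_uminus: "order_ge3 d F \<Longrightarrow> order_ge3 d (- F :: 'a::comm_ring_1 fps3)"
  by (simp add: order_ge3_def coeff3_def)

lemma coeff3_mult:
  "coeff3 (F * G :: 'a::comm_ring_1 fps3) i j l =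
     (\<Sum>c=0..l. \<Sum>b=0..j. \<Sum>a=0..i. coeff3 F a b c * coeff3 G (i - a) (j - b) (l - c))"
  by (simp add: coeff3_def fps_mult_nth fps_sum_nth)

lemma order_ge3_mult:
  assumes "order_ge3 d F" "order_ge3 e G"
  shows "order_ge3 (d + e) (F * G :: 'a::comm_ring_1 fps3)"
  unfolding order_ge3_def coeff3_mult
proof (intro allI impI sum.neutral ballI)
  fix i j l c b a
  assume *: "i + j + l < d + e" "c \<in> {0..l}" "b \<in> {0..j}" "a \<in> {0..i}"
  hence "a + b + c < d \<or> (i - a) + (j - b) + (l - c) < e"
    by auto
  thus "coeff3 F a b c * coeff3 G (i - a) (j - b) (l - c) = 0"
    using assms by (auto simp: order_ge3_def)
qed

lemma order_ge3_mult_right: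
  "order_ge3 e G \<Longrightarrow> order_ge3 e (F * G :: 'a::comm_ring_1 fps3)"
  using order_ge3_mult[of 0 F e G] by simp

lemma order_ge3_power:
  "order_ge3 d F \<Longrightarrow> order_ge3 (n * d) (F ^ n :: 'a::comm_ring_1 fps3)"
  by (induction n) (auto intro: order_ge3_mult)

lemma order_ge3_vars:
  "order_ge3 (Suc 0) varx" "order_ge3 (Suc 0) vary" "order_ge3 (Suc 0) varu"
  by (auto simp: order_ge3_def coeff3_def varx_def vary_def varu_def)

lemma locally_finite3I:
  assumes "\<And>s. s \<in> I \<Longrightarrow> order_ge3 (d s) (f s)" "\<And>n. finite {s\<in>I. d s \<le> n}"
  shows "locally_finite3 f I"
  unfolding locally_finite3_def
proof (intro allI)
  fix i j l
  have "{s\<in>I. coeff3 (f s) i j l \<noteq> 0} \<subseteq> {s\<in>I. d s \<le> i + j + l}"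
    using assms(1) by (force simp: order_ge3_def not_less[symmetric])
  thus "finite {s\<in>I. coeff3 (f s) i j l \<noteq> 0}"
    using assms(2) finite_subset by blast
qed

lemma locally_finite3_exp:
  assumes "coeff3 F 0 0 0 = 0"
  shows "locally_finite3 (\<lambda>m. const3 (c m) * F ^ m) (UNIV :: nat set)"
proof (rule locally_finite3I[where d = id])
  have "order_ge3 1 F"
    using assms by (simp add: order_ge3_def)
  thus "order_ge3 (id m) (const3 (c m) * F ^ m)" for m
    using order_ge3_power[of 1 F m] by (auto intro: order_ge3_mult_right)
qed (simp add: atMost_def[symmetric])

lemma locally_finite3_monomials:
  "locally_finite3 (\<lambda>(k, r, h). const3 (c k r h) * varx ^ (k - r) * vary ^ r * varu ^ h)
     {(k, r, h). k \<ge> r \<and> r \<ge> 1 \<and> h \<le> r}"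
proof (rule locally_finite3I[where d = "\<lambda>(k, r, h). (k - r) + r + h"])
  fix s :: "nat \<times> nat \<times> nat"
  obtain k r h where s: "s = (k, r, h)"
    by (cases s) auto
  have "order_ge3 ((k - r) + r + h)
          (const3 (c k r h) * varx ^ (k - r) * vary ^ r * varu ^ h)"
    using order_ge3_power[OF order_ge3_vars(1), of "k - r"]
      order_ge3_power[OF order_ge3_vars(2), of r] order_ge3_power[OF order_ge3_vars(3), of h]
    by (intro order_ge3_mult order_ge3_mult_right) auto
  thus "order_ge3 (case s of (k, r, h) \<Rightarrow> (k - r) + r + h)
      (case s of (k, r, h) \<Rightarrow> const3 (c k r h) * varx ^ (k - r) * vary ^ r * varu ^ h)"
    by (simp add: s)
next
  fix n :: nat
  have "{s \<in> {(k, r, h). k \<ge> r \<and> r \<ge> 1 \<and> h \<le> r}. (case s of (k, r, h) \<Rightarrow> (k - r) + r + h) \<le> n}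
          \<subseteq> {..n} \<times> {..n} \<times> {..n}"
    by auto
  thus "finite {s \<in> {(k, r, h). k \<ge> r \<and> r \<ge> 1 \<and> h \<le> r}.
          (case s of (k, r, h) \<Rightarrow> (k - r) + r + h) \<le> n}"
    by (rule finite_subset) auto
qed


section \<open>Power sums of two elements in terms of their sum and product\<close>

text \<open>
  The polynomial $P_n$ over $\mathbb{Z}$ with $P_n(\alpha + \beta, \alpha\beta) = \alpha^n + \beta^n$.
\<close>

fun power_sum2 :: "nat \<Rightarrow> 'a::comm_ring_1 \<Rightarrow> 'a \<Rightarrow> 'a" where
  "power_sum2 0 s t = 2"
| "power_sum2 (Suc 0) s t = s"
| "power_sum2 (Suc (Suc n)) s t = s * power_sum2 (Suc n) s t - t * power_sum2 n s t"

lemma power_sum2_correct: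
  fixes a b :: "'a::comm_ring_1"
  shows "power_sum2 n (a + b) (a * b) = a ^ n + b ^ n"
  by (induction n "a + b" "a * b" rule: power_sum2.induct) (simp_all add: algebra_simps)

lemma order_ge3_power_sum2:
  assumes "order_ge3 1 s" "order_ge3 2 t"
  shows "order_ge3 n (power_sum2 n s t :: 'a::comm_ring_1 fps3)"
  using assms
proof (induction n s t rule: power_sum2.induct)
  case (3 n s t)
  have "order_ge3 (1 + Suc n) (s * power_sum2 (Suc n) s t)"
    using 3 by (intro order_ge3_mult) auto
  moreover have "order_ge3 (2 + n) (t * power_sum2 n s t)"
    using 3 by (intro order_ge3_mult) auto
  ultimately show ?case
    by (auto intro: order_ge3_diff)
qed auto

lemma order_ge3_exponent_term:
  fixes c :: "'a::comm_ring_1"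
  shows "order_ge3 n
    (const3 c * (varx ^ n - power_sum2 n (varx - vary) (- (varx * vary * (1 - varu)))))"
proof -
  have "order_ge3 (Suc 0 + Suc 0 + 0) (varx * vary * (1 - varu) :: 'a fps3)"
    by (intro order_ge3_mult order_ge3_vars order_ge3_0)
  hence t: "order_ge3 2 (- (varx * vary * (1 - varu)) :: 'a fps3)"
    by (intro order_ge3_uminus) (simp add: numeral_2_eq_2)
  have s: "order_ge3 1 (varx - vary :: 'a fps3)"
    using order_ge3_vars by (auto intro: order_ge3_diff)
  have x: "order_ge3 n (varx ^ n :: 'a fps3)"
    using order_ge3_power[OF order_ge3_vars(1), of n] by simp
  show ?thesis
    by (rule order_ge3_mult_right[OF order_ge3_diff[OF x order_ge3_power_sum2[OF s t]]])
qed

lemma locally_finite3_exponent: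
  fixes c :: "nat \<Rightarrow> 'a::comm_ring_1"
  shows "locally_finite3 (\<lambda>n. const3 (c n) *
     (varx ^ n - power_sum2 n (varx - vary) (- (varx * vary * (1 - varu))))) {1..}"
proof (rule locally_finite3I[where d = "\<lambda>n. n"])
  show "finite {s \<in> {1..}. s \<le> n}" for n :: nat
    by (rule finite_subset[of _ "{..n}"]) auto
qed (rule order_ge3_exponent_term)

lemma exponent_const_coeff:
  fixes c :: "nat \<Rightarrow> 'a::comm_ring_1"
  shows "coeff3 (formal_sum3 (\<lambda>n. const3 (c n) *
     (varx ^ n - power_sum2 n (varx - vary) (- (varx * vary * (1 - varu))))) {1..}) 0 0 0 = 0"
proof -
  have "coeff3 (const3 (c n) *
     (varx ^ n - power_sum2 n (varx - vary) (- (varx * vary * (1 - varu))))) 0 0 0 = 0"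
    if "n \<ge> 1" for n
    using order_ge3_exponent_term[of n "c n"] that unfolding order_ge3_def by simp
  thus ?thesis
    unfolding coeff3_formal_sum3 by (intro sum.neutral) auto
qed

end

theory Submission
  imports Defs "HOL-Library.Function_Algebras"
begin

text \<open>
  Fix an odd prime $p$ and write $a_n$ for $1/n$ modulo $p$, where $0 < n < p/2$. An index together
  with a summand of its zeta value is the same as a choice, for every $n$, either to skip $n$ or to
  give it an exponent $k \ge 1$, which contributes $a_n^k\, x^{k-1} y$, and in addition $u$ if
  $k \ge 2$. So the generating series is a finite product over $n$ of the factors
  \[ 1 + a_n y + \frac{a_n^2\, x y u}{1 - a_n x}
       = \frac{1 - a_n (x - y) - a_n^2\, x y (1 - u)}{1 - a_n x}
       = \frac{(1 - a_n \alpha)(1 - a_n \beta)}{1 - a_n x}, \]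
  and the theorem is obtained by taking logarithms: the logarithm of this factor is the sum over
  $m \ge 1$ of $a_n^m (x^m - \alpha^m - \beta^m)/m$, and the sum of $a_n^m$ over $n$ is the $p$-component
  of $\zeta(m)$.

  The logarithm needs division by all integers, which is possible in $\mathcal A$ but not
  modulo a single prime. It is therefore replaced by a logarithmic derivative. Let $D$ be the Euler
  derivation that multiplies a monomial by its total degree in $x$ and $y$. Since $\alpha + \beta$
  and $\alpha\beta$ are homogeneous of degrees 1 and 2, $D$ multiplies
  $x^m - \alpha^m - \beta^m$ by $m$ and cancels the denominators, and the generating series $L$
  satisfies
  \[ D L = L \cdot \sum_{m \ge 1} \zeta(m)\, (x^m - \alpha^m - \beta^m). \]
  This is an identity between nested sums of arbitrary elements $a_1, \ldots, a_N$ of an integral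
  domain, proved by adding one element at a time (\<open>euler3_index_series_nested_sum\<close>). It holds in
  particular for integers representing the $a_n$ modulo $p$. All its coefficients are
  polynomial in the nested sums, so it holds in the ring of all families of integers indexed by $p$
  and passes to the quotient $\mathcal A$ (\<open>euler3_index_series_zeta2\<close>). There, every positive
  integer is invertible; the exponential solves the same equation
  (\<open>euler3_formal_exp3\<close>), and a solution is determined by its terms free of $x$ and $y$
  (\<open>euler3_equation_unique\<close>).
\<close>


section \<open>Coefficients of power series in three variables\<close>

definition fps3_of :: "(nat \<Rightarrow> nat \<Rightarrow> nat \<Rightarrow> 'a) \<Rightarrow> 'a fps3" where
  "fps3_of c = Abs_fps (\<lambda>l. Abs_fps (\<lambda>j. Abs_fps (\<lambda>i. c i j l)))"

lemma coeff3_fps3_of [simp]: "coeff3 (fps3_of c) i j l = c i j l"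
  by (simp add: coeff3_def fps3_of_def)

lemma coeff3_0 [simp]: "coeff3 0 i j l = 0"
  by (simp add: coeff3_def)

lemma coeff3_add [simp]: "coeff3 (F + G :: 'a::comm_ring_1 fps3) i j l = coeff3 F i j l + coeff3 G i j l"
  by (simp add: coeff3_def)

lemma coeff3_diff [simp]: "coeff3 (F - G :: 'a::comm_ring_1 fps3) i j l = coeff3 F i j l - coeff3 G i j l"
  by (simp add: coeff3_def)

lemma coeff3_uminus [simp]: "coeff3 (- F :: 'a::comm_ring_1 fps3) i j l = - coeff3 F i j l"
  by (simp add: coeff3_def)

lemma coeff3_sum [simp]:
  "coeff3 (sum f I :: 'a::comm_ring_1 fps3) i j l = (\<Sum>s\<in>I. coeff3 (f s) i j l)"
  by (simp add: coeff3_def fps_sum_nth)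

lemma coeff3_const3 [simp]: "coeff3 (const3 c) i j l = (if i = 0 \<and> j = 0 \<and> l = 0 then c else 0)"
  by (simp add: coeff3_def const3_def)

lemma coeff3_1 [simp]:
  "coeff3 (1 :: 'a::comm_ring_1 fps3) i j l = (if i = 0 \<and> j = 0 \<and> l = 0 then 1 else 0)"
  by (simp add: coeff3_def)

lemma coeff3_const3_mult [simp]:
  "coeff3 (const3 c * F :: 'a::comm_ring_1 fps3) i j l = c * coeff3 F i j l"
  by (simp add: coeff3_def const3_def)

lemma coeff3_varx_mult [simp]:
  "coeff3 (varx * F :: 'a::comm_ring_1 fps3) i j l = (if i = 0 then 0 else coeff3 F (i - 1) j l)"
  by (simp add: coeff3_def varx_def)

lemma coeff3_vary_mult [simp]:
  "coeff3 (vary * F :: 'a::comm_ring_1 fps3) i j l = (if j = 0 then 0 else coeff3 F i (j - 1) l)"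
  by (simp add: coeff3_def vary_def)

lemma coeff3_varu_mult [simp]:
  "coeff3 (varu * F :: 'a::comm_ring_1 fps3) i j l = (if l = 0 then 0 else coeff3 F i j (l - 1))"
  by (simp add: coeff3_def varu_def)

lemma coeff3_series_in_x_mult:
  "coeff3 (fps_const (fps_const h) * F :: 'a::comm_ring_1 fps3) i j l =
     (\<Sum>m=0..i. fps_nth h m * coeff3 F (i - m) j l)"
  unfolding coeff3_def by simp (simp add: fps_mult_nth)

lemma const3_mult: "const3 (a * b :: 'a::comm_ring_1) = const3 a * const3 b"
  by (simp add: const3_def)

lemma const3_add: "const3 (a + b :: 'a::comm_ring_1) = const3 a + const3 b"
  by (simp add: const3_def)

lemma const3_0 [simp]: "const3 0 = 0"
  by (simp add: const3_def)

lemma const3_1 [simp]: "const3 1 = 1"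
  by (simp add: const3_def)

lemma const3_power: "const3 (a ^ n :: 'a::comm_ring_1) = const3 a ^ n"
  by (induction n) (simp_all add: const3_mult)

lemma const3_of_nat: "const3 (of_nat n :: 'a::comm_ring_1) = of_nat n"
  by (induction n) (simp_all add: const3_add)

lemma coeff3_of_nat_mult [simp]:
  "coeff3 (of_nat n * F :: 'a::comm_ring_1 fps3) i j l = of_nat n * coeff3 F i j l"
  by (simp flip: const3_of_nat)

lemma coeff3_monomial:
  "coeff3 (const3 c * varx ^ a * vary ^ b * varu ^ d :: 'a::comm_ring_1 fps3) i j l =
     (if i = a \<and> j = b \<and> l = d then c else 0)"
proof -
  have "coeff3 (varu ^ d * (vary ^ b * (varx ^ a * const3 c)) :: 'a fps3) i j l =
     (if i = a \<and> j = b \<and> l = d then c else 0)"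
  proof (induction d arbitrary: l)
    case 0
    show ?case
    proof (induction b arbitrary: j)
      case 0
      show ?case
        by (induction a arbitrary: i) (auto simp: mult.assoc)
    qed (auto simp: mult.assoc)
  qed (auto simp: mult.assoc)
  thus ?thesis
    by (simp add: ac_simps)
qed

text \<open>
  Equality of two infinite sums is proved below by comparing truncations: the truncation identities
  have error terms whose order grows with the length of the truncation.
\<close>

lemma order_ge3_imp_eq:
  assumes "\<And>d. order_ge3 d (F - G :: 'a::comm_ring_1 fps3)"
  shows "F = G"
proof (rule fps3_eqI)
  show "coeff3 F i j l = coeff3 G i j l" for i j l
    using assms[of "Suc (i + j + l)"] by (simp add: order_ge3_def)
qed

lemma formal_sum3_tail:
  fixes f :: "nat \<Rightarrow> 'a::comm_ring_1 fps3"
  assumes "\<And>s. s \<in> I \<Longrightarrow> order_ge3 s (f s)"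
  shows "order_ge3 (Suc M) (formal_sum3 f I - (\<Sum>s\<in>I \<inter> {..M}. f s))"
  unfolding order_ge3_def
proof (intro allI impI)
  fix i j l assume "i + j + l < Suc M"
  hence "{s\<in>I. coeff3 (f s) i j l \<noteq> 0} \<subseteq> I \<inter> {..M}"
    using assms by (force simp: order_ge3_def not_less[symmetric])
  hence "coeff3 (formal_sum3 f I) i j l = (\<Sum>s\<in>I \<inter> {..M}. coeff3 (f s) i j l)"
    unfolding coeff3_formal_sum3 by (intro sum.mono_neutral_left) auto
  thus "coeff3 (formal_sum3 f I - (\<Sum>s\<in>I \<inter> {..M}. f s)) i j l = 0"
    by simp
qed

lemma coeff3_formal_sum3_truncate:
  fixes f :: "nat \<Rightarrow> 'a::comm_ring_1 fps3"
  assumes "\<And>s. s \<in> I \<Longrightarrow> order_ge3 s (f s)"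
  shows "coeff3 (formal_sum3 f I) i j l = (\<Sum>s\<in>I \<inter> {..i + j + l}. coeff3 (f s) i j l)"
  using formal_sum3_tail[OF assms, of I "i + j + l"] by (simp add: order_ge3_def)


section \<open>The Euler derivation in x and y\<close>

definition euler3 :: "'a::comm_ring_1 fps3 \<Rightarrow> 'a fps3" where
  "euler3 F = fps3_of (\<lambda>i j l. of_nat (i + j) * coeff3 F i j l)"

lemma coeff3_euler3 [simp]: "coeff3 (euler3 F) i j l = of_nat (i + j) * coeff3 F i j l"
  by (simp add: euler3_def)

lemma euler3_add: "euler3 (F + G) = euler3 F + euler3 G"
  by (rule fps3_eqI) (simp add: algebra_simps)

lemma euler3_diff: "euler3 (F - G) = euler3 F - euler3 G"
  by (rule fps3_eqI) (simp add: algebra_simps)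

lemma euler3_const3 [simp]: "euler3 (const3 c) = 0"
  by (rule fps3_eqI) simp

lemma euler3_1 [simp]: "euler3 1 = 0"
  by (rule fps3_eqI) simp

lemma euler3_mult: "euler3 (F * G) = euler3 F * G + F * euler3 G"
proof (rule fps3_eqI)
  fix i j l
  have "of_nat (i + j) * (coeff3 F a b c * coeff3 G (i - a) (j - b) (l - c)) =
      of_nat (a + b) * coeff3 F a b c * coeff3 G (i - a) (j - b) (l - c) +
      coeff3 F a b c * (of_nat (i - a + (j - b)) * coeff3 G (i - a) (j - b) (l - c))"
    if "a \<in> {0..i}" "b \<in> {0..j}" for a b c
  proof -
    have "(of_nat (i + j) :: 'a) = of_nat ((a + b) + (i - a + (j - b)))"
      using that by (intro arg_cong[where f = of_nat]) auto
    also have "\<dots> = of_nat (a + b) + of_nat (i - a + (j - b))"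
      by (rule of_nat_add)
    finally show ?thesis
      by (simp only: distrib_right) (simp only: ac_simps)
  qed
  thus "coeff3 (euler3 (F * G)) i j l = coeff3 (euler3 F * G + F * euler3 G) i j l"
    by (simp add: coeff3_mult sum_distrib_left flip: sum.distrib)
qed

lemma euler3_power_Suc: "euler3 (F ^ Suc n) = of_nat (Suc n) * F ^ n * euler3 F"
proof (induction n)
  case (Suc n)
  have "euler3 (F ^ Suc (Suc n)) = euler3 F * F ^ Suc n + F * euler3 (F ^ Suc n)"
    by (simp only: power_Suc[of F "Suc n"] euler3_mult)
  thus ?case
    unfolding Suc by (simp add: algebra_simps)
qed simp

lemma coeff3_varx [simp]:
  "coeff3 (varx :: 'a::comm_ring_1 fps3) i j l = (if i = 1 \<and> j = 0 \<and> l = 0 then 1 else 0)"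
  using coeff3_varx_mult[of 1 i j l] by auto

lemma euler3_varx [simp]: "euler3 varx = varx"
  by (rule fps3_eqI) simp

lemma coeff3_vary [simp]:
  "coeff3 (vary :: 'a::comm_ring_1 fps3) i j l = (if i = 0 \<and> j = 1 \<and> l = 0 then 1 else 0)"
  using coeff3_vary_mult[of 1 i j l] by auto

lemma euler3_vary [simp]: "euler3 vary = vary"
  by (rule fps3_eqI) simp

lemma coeff3_varu [simp]:
  "coeff3 (varu :: 'a::comm_ring_1 fps3) i j l = (if i = 0 \<and> j = 0 \<and> l = 1 then 1 else 0)"
  using coeff3_varu_mult[of 1 i j l] by auto

lemma euler3_varu [simp]: "euler3 varu = 0"
  by (rule fps3_eqI) simp

lemma order_ge3_euler3: "order_ge3 d F \<Longrightarrow> order_ge3 d (euler3 F)"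
  by (simp add: order_ge3_def)

text \<open>
  The coefficients of a solution are determined recursively by the degree in $x$ and $y$: as $K$ has
  no terms free of $x$ and $y$, a coefficient of $E K$ in degree $d$ involves only coefficients of
  $E$ in degrees below $d$, whereas the left-hand side is $d$ times the coefficient of $E$. Degree
  zero gives no condition, hence the initial values, one for each power of $u$.
\<close>

lemma euler3_equation_unique:
  fixes E E' K :: "'a::comm_ring_1 fps3"
  assumes cancel: "\<And>n c. n > 0 \<Longrightarrow> of_nat n * c = (0::'a) \<Longrightarrow> c = 0"
    and K: "\<And>l. coeff3 K 0 0 l = 0"
    and E: "euler3 E = E * K" and E': "euler3 E' = E' * K"
    and init: "\<And>l. coeff3 E 0 0 l = coeff3 E' 0 0 l"
  shows "E = E'"
proof -
  define W where "W = E - E'"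
  have W: "euler3 W = W * K"
    by (simp add: W_def euler3_diff E E' left_diff_distrib)
  have "coeff3 W i j l = 0" for i j l
  proof (induction "i + j" arbitrary: i j l rule: less_induct)
    case less
    show ?case
    proof (cases "i + j = 0")
      case True
      thus ?thesis by (simp add: W_def init)
    next
      case False
      have "coeff3 W a b c * coeff3 K (i - a) (j - b) (l - c) = 0"
        if "a \<le> i" "b \<le> j" for a b c
      proof (cases "a = i \<and> b = j")
        case True
        thus ?thesis by (simp add: K)
      next
        case False
        hence "a + b < i + j" using that by auto
        thus ?thesis using less by simp
      qed
      hence "coeff3 (W * K) i j l = 0"
        unfolding coeff3_mult by (intro sum.neutral ballI) simp
      hence "of_nat (i + j) * coeff3 W i j l = 0"
        by (simp flip: W)
      thus ?thesis
        using cancel[of "i + j"] False by blast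
    qed
  qed
  hence "W = 0"
    by (intro fps3_eqI) simp
  thus ?thesis
    by (simp add: W_def)
qed


section \<open>The formal exponential\<close>

lemma inverse_fact_Suc:
  assumes div: "\<And>n. n > 0 \<Longrightarrow> of_nat n * (1 / of_nat n) = (1::'a::{comm_ring_1,inverse})"
  shows "1 / of_nat (fact (Suc m)) * of_nat (Suc m) = (1 / of_nat (fact m) :: 'a)"
proof -
  define w :: 'a where "w = of_nat (fact m)"
  define s :: 'a where "s = of_nat (Suc m)"
  define i where "i = 1 / (of_nat (fact (Suc m)) :: 'a)"
  have "(of_nat (fact (Suc m)) :: 'a) = w * s"
    by (simp add: w_def s_def algebra_simps)
  hence "w * s * i = 1"
    using div[of "fact (Suc m)"] by (simp only: i_def fact_gt_zero)
  moreover have w: "w * (1 / w) = 1"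
    unfolding w_def by (rule div) simp
  ultimately have "i * s = (w * s * i) * (1 / w)"
    by (metis mult.assoc mult.commute mult.right_neutral)
  with \<open>w * s * i = 1\<close> have "i * s = 1 / w"
    by simp
  thus ?thesis
    by (simp only: i_def s_def w_def)
qed

lemma order_ge3_exp_term:
  assumes "coeff3 F 0 0 0 = 0"
  shows "order_ge3 m (const3 c * F ^ m :: 'a::comm_ring_1 fps3)"
proof -
  have "order_ge3 1 F"
    using assms by (simp add: order_ge3_def)
  thus ?thesis
    using order_ge3_power[of 1 F m] by (auto intro: order_ge3_mult_right)
qed

text \<open>
  The terms $t_m = F^m / m!$ satisfy $D t_{m+1} = t_m\, D F$, so $D$ of a partial sum is
  $D F$ times the partial sum that is one term shorter.
\<close>

lemma euler3_formal_exp3: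
  fixes F :: "'a::{comm_ring_1,inverse} fps3"
  assumes div: "\<And>n. n > 0 \<Longrightarrow> of_nat n * (1 / of_nat n) = (1::'a)"
    and F: "coeff3 F 0 0 0 = 0"
  shows "euler3 (formal_exp3 F) = formal_exp3 F * euler3 F"
proof (rule order_ge3_imp_eq)
  fix M
  define t where "t m = const3 (1 / of_nat (fact m)) * F ^ m" for m
  have "order_ge3 m (t m)" for m
    unfolding t_def by (rule order_ge3_exp_term[OF F])
  moreover have "formal_exp3 F = formal_sum3 t UNIV"
    by (simp add: formal_exp3_def t_def[abs_def])
  ultimately have tail: "order_ge3 (Suc M) (formal_exp3 F - (\<Sum>m\<le>M. t m))" for M
    using formal_sum3_tail[of UNIV t M] by simp
  have t_Suc: "euler3 (t (Suc m)) = t m * euler3 F" for m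
  proof -
    have "euler3 (t (Suc m)) =
        const3 (1 / of_nat (fact (Suc m))) * of_nat (Suc m) * F ^ m * euler3 F"
      by (simp only: t_def euler3_mult euler3_const3 euler3_power_Suc) (simp add: mult.assoc)
    also have "const3 (1 / of_nat (fact (Suc m))) * of_nat (Suc m) = const3 (1 / of_nat (fact m) :: 'a)"
      unfolding const3_of_nat[symmetric] const3_mult[symmetric]
      by (rule arg_cong[where f = const3], rule inverse_fact_Suc, rule div)
    finally show ?thesis
      by (simp add: t_def)
  qed
  have trunc: "euler3 (\<Sum>m\<le>Suc M. t m) = (\<Sum>m\<le>M. t m) * euler3 F"
  proof (induction M)
    case 0
    have "euler3 (t 0) = 0"
      by (simp add: t_def euler3_mult)
    thus ?case
      by (simp add: euler3_add t_Suc)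
  next
    case (Suc M)
    show ?case
      unfolding sum.atMost_Suc[of t "Suc M"] euler3_add Suc t_Suc
      by (simp add: distrib_right)
  qed
  define R where "R = formal_exp3 F - (\<Sum>m\<le>Suc M. t m)"
  define R' where "R' = formal_exp3 F - (\<Sum>m\<le>M. t m)"
  have "euler3 (formal_exp3 F) = euler3 (\<Sum>m\<le>Suc M. t m) + euler3 R"
    unfolding euler3_add[symmetric] R_def by simp
  moreover have "formal_exp3 F * euler3 F = (\<Sum>m\<le>M. t m) * euler3 F + euler3 F * R'"
    by (simp add: R'_def algebra_simps)
  ultimately have "euler3 (formal_exp3 F) - formal_exp3 F * euler3 F = euler3 R - euler3 F * R'"
    unfolding trunc by simp
  moreover have "order_ge3 M (euler3 R)"
    by (rule order_ge3_euler3, rule order_ge3_mono, unfold R_def, rule tail) simp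
  moreover have "order_ge3 M (euler3 F * R')"
    by (rule order_ge3_mult_right, rule order_ge3_mono, unfold R'_def, rule tail) simp
  ultimately show "order_ge3 M (euler3 (formal_exp3 F) - formal_exp3 F * euler3 F)"
    by (simp add: order_ge3_diff)
qed

lemma coeff3_power_00:
  assumes "\<And>l. coeff3 F 0 0 l = 0" "m > 0"
  shows "coeff3 (F ^ m :: 'a::comm_ring_1 fps3) 0 0 l = 0"
  using assms(2)
proof (cases m)
  case (Suc n)
  thus ?thesis
    using assms(1) by (simp add: coeff3_mult)
qed simp

lemma coeff3_formal_exp3_00:
  fixes F :: "'a::{comm_ring_1,inverse} fps3"
  assumes div: "\<And>n. n > 0 \<Longrightarrow> of_nat n * (1 / of_nat n) = (1::'a)"
    and F: "\<And>l. coeff3 F 0 0 l = 0"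
  shows "coeff3 (formal_exp3 F) 0 0 l = (if l = 0 then 1 else 0)"
proof -
  have "coeff3 (formal_exp3 F) 0 0 l =
      (\<Sum>m\<le>l. coeff3 (const3 (1 / of_nat (fact m)) * F ^ m) 0 0 l)"
    unfolding formal_exp3_def
    by (subst coeff3_formal_sum3_truncate) (auto intro: order_ge3_exp_term F)
  also have "\<dots> = (\<Sum>m\<in>{0}. coeff3 (const3 (1 / of_nat (fact m)) * F ^ m) 0 0 l)"
    by (intro sum.mono_neutral_right) (auto simp: coeff3_power_00[OF F])
  also have "\<dots> = (if l = 0 then 1 else 0)"
    using div[of 1] by simp
  finally show ?thesis .
qed


section \<open>Power sums\<close>

text \<open>
  The elements $\sigma = \alpha + \beta$ and $\pi = \alpha\beta$. Neither $\alpha$ nor $\beta$ lies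
  in the power series ring, so only these two are available.
\<close>

definition \<sigma> :: "'a::comm_ring_1 fps3" where "\<sigma> = varx - vary"
definition \<pi> :: "'a::comm_ring_1 fps3" where "\<pi> = - (varx * vary * (1 - varu))"

definition power_sum_diff :: "nat \<Rightarrow> 'a::comm_ring_1 fps3" where
  "power_sum_diff n = varx ^ n - power_sum2 n \<sigma> \<pi>"

definition power_sum_series :: "(nat \<Rightarrow> 'a::comm_ring_1) \<Rightarrow> 'a fps3" where
  "power_sum_series z = formal_sum3 (\<lambda>n. const3 (z n) * power_sum_diff n) {1..}"

lemma order_ge3_power_sum_diff: "order_ge3 n (const3 c * power_sum_diff n)"
  unfolding power_sum_diff_def \<sigma>_def \<pi>_def by (rule order_ge3_exponent_term)

lemma power_sum_series_tail:
  "order_ge3 (Suc M) (power_sum_series z - (\<Sum>n=1..M. const3 (z n) * power_sum_diff n))"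
proof -
  have "{1..} \<inter> {..M} = {1..M}" by auto
  thus ?thesis
    using formal_sum3_tail[where I = "{1..}" and M = M, OF order_ge3_power_sum_diff[of _ "z _"]]
    by (simp only: power_sum_series_def)
qed

lemma coeff3_power_sum_series:
  "coeff3 (power_sum_series z) i j l =
     (\<Sum>n=1..i + j + l. z n * coeff3 (power_sum_diff n) i j l)"
  using power_sum_series_tail[of "i + j + l" z] by (simp add: order_ge3_def)

lemma power_sum_series_add:
  "power_sum_series (\<lambda>n. z n + z' n) = power_sum_series z + power_sum_series z'"
  by (rule fps3_eqI) (simp add: coeff3_power_sum_series distrib_right sum.distrib)

lemma euler3_\<sigma>: "euler3 \<sigma> = \<sigma>"
  by (simp add: \<sigma>_def euler3_diff)

lemma euler3_\<pi>: "euler3 \<pi> = (2 * \<pi> :: 'a::comm_ring_1 fps3)"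
proof -
  have "\<pi> = varx * vary * (varu - 1 :: 'a fps3)"
    by (simp add: \<pi>_def algebra_simps)
  show ?thesis
    unfolding \<open>\<pi> = _\<close> by (simp add: euler3_mult euler3_diff algebra_simps)
qed

text \<open>
  Euler's identity for $\alpha^n + \beta^n$, which is homogeneous of degree $n$ in $x$ and $y$; this
  is why $u$ is given degree zero.
\<close>

lemma euler3_power_sum2:
  "euler3 (power_sum2 n \<sigma> \<pi>) = of_nat n * power_sum2 n \<sigma> (\<pi> :: 'a::comm_ring_1 fps3)"
proof (induction n "\<sigma> :: 'a fps3" "\<pi> :: 'a fps3" rule: power_sum2.induct)
  case 1
  have "const3 2 = (2 :: 'a fps3)"
    using const3_of_nat[of 2, where ?'a = 'a] by simp
  hence "euler3 (2 :: 'a fps3) = 0"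
    using euler3_const3[of "2 :: 'a"] by simp
  thus ?case by simp
next
  case 2
  show ?case by (simp add: euler3_\<sigma>)
next
  case (3 n)
  have "euler3 (power_sum2 (Suc (Suc n)) \<sigma> (\<pi> :: 'a fps3)) =
     \<sigma> * power_sum2 (Suc n) \<sigma> \<pi> + \<sigma> * (of_nat (Suc n) * power_sum2 (Suc n) \<sigma> \<pi>)
     - (2 * \<pi> * power_sum2 n \<sigma> \<pi> + \<pi> * (of_nat n * power_sum2 n \<sigma> \<pi>))"
    unfolding power_sum2.simps euler3_diff euler3_mult 3 euler3_\<pi>
    by (simp add: euler3_\<sigma>)
  also have "\<dots> = of_nat (Suc (Suc n)) * power_sum2 (Suc (Suc n)) \<sigma> \<pi>"
    unfolding power_sum2.simps by (simp add: algebra_simps)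
  finally show ?case .
qed

lemma euler3_power_sum_diff:
  assumes "n > 0"
  shows "euler3 (power_sum_diff n) = of_nat n * (power_sum_diff n :: 'a::comm_ring_1 fps3)"
proof -
  obtain m where n: "n = Suc m" using assms by (cases n) auto
  have "euler3 (varx ^ n) = (of_nat n * varx ^ n :: 'a fps3)"
    unfolding n euler3_power_Suc by (simp only: euler3_varx power_Suc ac_simps)
  thus ?thesis
    by (simp add: power_sum_diff_def euler3_diff euler3_power_sum2 right_diff_distrib)
qed

lemma euler3_power_sum_series:
  fixes w z :: "nat \<Rightarrow> 'a::comm_ring_1"
  assumes div: "\<And>n. n > 0 \<Longrightarrow> of_nat n * w n = z n"
  shows "euler3 (power_sum_series w) = power_sum_series z"
proof (rule fps3_eqI)
  fix i j l
  have "of_nat (i + j) * (w n * coeff3 (power_sum_diff n) i j l) =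
      z n * coeff3 (power_sum_diff n) i j l" if "n \<in> {1..i + j + l}" for n
  proof -
    have n: "n > 0" using that by simp
    have "of_nat (i + j) * coeff3 (power_sum_diff n) i j l =
        of_nat n * coeff3 (power_sum_diff n :: 'a fps3) i j l"
      using arg_cong[OF euler3_power_sum_diff[OF n], of "\<lambda>F. coeff3 F i j l"] by simp
    thus ?thesis
      unfolding div[OF n, symmetric] by (metis mult.assoc mult.commute)
  qed
  thus "coeff3 (euler3 (power_sum_series w)) i j l = coeff3 (power_sum_series z) i j l"
    by (simp add: coeff3_power_sum_series sum_distrib_left del: of_nat_add)
qed


lemma truncated_geometric:
  "(1 - c) * (\<Sum>n=1..M. c ^ n) = c - c ^ Suc M" for c :: "'a::comm_ring_1"
proof (induction M)
  case (Suc M)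
  have "(1 - c) * (\<Sum>n=1..Suc M. c ^ n) = (1 - c) * (\<Sum>n=1..M. c ^ n) + (1 - c) * c ^ Suc M"
    by (simp add: distrib_left)
  also have "\<dots> = c - c ^ Suc (Suc M)"
    unfolding Suc by (simp add: algebra_simps)
  finally show ?case .
qed simp

text \<open>
  Here $1 - c s + c^2 t = (1 - c\alpha)(1 - c\beta)$ for $s = \alpha + \beta$, $t = \alpha\beta$. The
  right-hand side without its last two terms is the numerator of
  $\frac{c\alpha}{1 - c\alpha} + \frac{c\beta}{1 - c\beta}$.
\<close>

lemma truncated_power_sum2:
  fixes c s t :: "'a::comm_ring_1"
  shows "(1 - c * s + c\<^sup>2 * t) * (\<Sum>n=1..M. c ^ n * power_sum2 n s t) =
    c * s - 2 * c\<^sup>2 * t - c ^ Suc M * power_sum2 (Suc M) s t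
      + t * c\<^sup>2 * (c ^ M * power_sum2 M s t)"
proof (induction M)
  case (Suc M)
  let ?f = "\<lambda>n. c ^ n * power_sum2 n s t"
  have "(1 - c * s + c\<^sup>2 * t) * sum ?f {1..Suc M} =
      (1 - c * s + c\<^sup>2 * t) * sum ?f {1..M} + (1 - c * s + c\<^sup>2 * t) * ?f (Suc M)"
    by (simp add: distrib_left)
  also have "\<dots> = c * s - 2 * c\<^sup>2 * t - c ^ Suc (Suc M) * power_sum2 (Suc (Suc M)) s t
      + t * c\<^sup>2 * (c ^ Suc M * power_sum2 (Suc M) s t)"
    unfolding Suc by (simp add: algebra_simps power2_eq_square)
  finally show ?case .
qed (simp add: algebra_simps)

definition linear_factor :: "'a::comm_ring_1 \<Rightarrow> 'a fps3" where
  "linear_factor a = 1 - const3 a * varx"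

definition quadratic_factor :: "'a::comm_ring_1 \<Rightarrow> 'a fps3" where
  "quadratic_factor a = 1 - const3 a * \<sigma> + (const3 a)\<^sup>2 * \<pi>"

lemma euler3_linear_factor: "euler3 (linear_factor a) = - (const3 a * varx)"
  by (simp add: linear_factor_def euler3_diff euler3_mult)

lemma euler3_quadratic_factor:
  "euler3 (quadratic_factor a) = - (const3 a * \<sigma>) + 2 * (const3 a)\<^sup>2 * \<pi>"
proof -
  have "euler3 ((const3 a)\<^sup>2) = 0"
    by (simp flip: const3_power)
  thus ?thesis
    unfolding quadratic_factor_def euler3_add euler3_diff euler3_mult euler3_\<sigma> euler3_\<pi>
    by (simp add: algebra_simps)
qed

text \<open>
  With $A = 1 - a x$ and $B = (1 - a\alpha)(1 - a\beta)$, this is the logarithmic derivative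
  $\frac{D B}{B} - \frac{D A}{A}$ of $B / A$, with denominators cleared.
\<close>

lemma power_sum_series_geometric:
  "linear_factor a * quadratic_factor a * power_sum_series (\<lambda>n. a ^ n) =
     linear_factor a * euler3 (quadratic_factor a) - quadratic_factor a * euler3 (linear_factor a)"
proof (rule order_ge3_imp_eq)
  fix M
  \<comment> \<open>Truncating at $M$ leaves the remainder $R$ and the error terms of the two truncated sums,
    all of order at least $M$.\<close>
  define c where "c = const3 a"
  define p where "p n = power_sum2 n \<sigma> (\<pi> :: 'a fps3)" for n
  define A where "A = linear_factor a"
  define B where "B = quadratic_factor a"
  define R where "R = power_sum_series (\<lambda>n. a ^ n) - (\<Sum>n=1..M. const3 (a ^ n) * power_sum_diff n)"
  have "(\<Sum>n=1..M. const3 (a ^ n) * power_sum_diff n) =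
      (\<Sum>n=1..M. (c * varx) ^ n) - (\<Sum>n=1..M. c ^ n * p n)"
    by (simp add: const3_power power_sum_diff_def c_def p_def right_diff_distrib
        power_mult_distrib sum_subtractf)
  hence T: "power_sum_series (\<lambda>n. a ^ n) = R + (\<Sum>n=1..M. (c * varx) ^ n) - (\<Sum>n=1..M. c ^ n * p n)"
    by (simp add: R_def)
  have "A * B * power_sum_series (\<lambda>n. a ^ n) =
      A * B * R + B * (A * (\<Sum>n=1..M. (c * varx) ^ n)) - A * (B * (\<Sum>n=1..M. c ^ n * p n))"
    unfolding T by (simp add: algebra_simps)
  also have "A * (\<Sum>n=1..M. (c * varx) ^ n) = c * varx - (c * varx) ^ Suc M"
    unfolding A_def linear_factor_def c_def by (rule truncated_geometric)
  also have "B * (\<Sum>n=1..M. c ^ n * p n) =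
      c * \<sigma> - 2 * c\<^sup>2 * \<pi> - c ^ Suc M * p (Suc M) + \<pi> * c\<^sup>2 * (c ^ M * p M)"
    unfolding B_def quadratic_factor_def c_def p_def by (rule truncated_power_sum2)
  finally have eq: "A * B * power_sum_series (\<lambda>n. a ^ n) - (A * euler3 B - B * euler3 A) =
      A * B * R - B * (c * varx) ^ Suc M
        - (A * (\<pi> * c\<^sup>2 * (c ^ M * p M)) - A * (c ^ Suc M * p (Suc M)))"
    unfolding A_def B_def euler3_linear_factor euler3_quadratic_factor c_def[symmetric]
    by (simp add: algebra_simps)
  have "order_ge3 1 \<sigma>" "order_ge3 2 \<pi>"
    by (auto simp: order_ge3_def \<sigma>_def \<pi>_def mult.assoc)
  hence p: "order_ge3 n (p n)" for n
    unfolding p_def by (rule order_ge3_power_sum2)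
  have "order_ge3 (Suc M) R"
    unfolding R_def by (rule power_sum_series_tail)
  moreover have "order_ge3 (Suc M) ((c * varx) ^ Suc M)"
    using order_ge3_power[OF order_ge3_mult_right[OF order_ge3_vars(1)], of "Suc M" c] by simp
  ultimately have "order_ge3 M R" "order_ge3 M ((c * varx) ^ Suc M)" "order_ge3 M (p (Suc M))"
    using p[of "Suc M"] by (auto elim: order_ge3_mono)
  thus "order_ge3 M (linear_factor a * quadratic_factor a * power_sum_series (\<lambda>n. a ^ n) -
      (linear_factor a * euler3 (quadratic_factor a) - quadratic_factor a * euler3 (linear_factor a)))"
    unfolding A_def[symmetric] B_def[symmetric] eq
    by (intro order_ge3_diff order_ge3_mult_right p)
qed


section \<open>Nested power sums over a finite family\<close>

text \<open>
  Nested power sums of arbitrary ring elements $a_1, \ldots, a_N$ replace the zeta values; the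
  zeta values modulo $p$ are the case where $a_n$ is an inverse of $n$.
\<close>

definition increasing_lists :: "nat \<Rightarrow> nat \<Rightarrow> nat list set" where
  "increasing_lists N r = {ns. length ns = r \<and> sorted_wrt (<) ns \<and> set ns \<subseteq> {1..N}}"

definition nested_sum :: "(nat \<Rightarrow> 'a::comm_ring_1) \<Rightarrow> nat \<Rightarrow> nat list \<Rightarrow> 'a" where
  "nested_sum a N ks =
     (\<Sum>ns\<in>increasing_lists N (length ks). \<Prod>j<length ks. a (ns ! j) ^ (ks ! j))"

lemma finite_increasing_lists [simp]: "finite (increasing_lists N r)"
  unfolding increasing_lists_def
  by (rule finite_subset[OF _ finite_lists_length_eq[of "{1..N}" r]]) auto

lemma increasing_lists_0 [simp]: "increasing_lists N 0 = {[]}"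
  by (auto simp: increasing_lists_def)

lemma increasing_lists_0_Suc [simp]: "increasing_lists 0 (Suc r) = {}"
  by (auto simp: increasing_lists_def)

lemma append_in_increasing_lists_iff:
  "ns @ [m] \<in> increasing_lists N (Suc r) \<longleftrightarrow>
     ns \<in> increasing_lists (m - 1) r \<and> 1 \<le> m \<and> m \<le> N"
proof -
  have "(\<forall>n\<in>set ns. n < m) \<and> set ns \<subseteq> {1..N} \<longleftrightarrow> set ns \<subseteq> {1..m - 1}" if "1 \<le> m" "m \<le> N"
    using that by (force simp: subset_iff)
  thus ?thesis
    by (auto simp: increasing_lists_def sorted_wrt_append)
qed

lemma increasing_lists_Suc_Suc:
  "increasing_lists (Suc N) (Suc r) =
     increasing_lists N (Suc r) \<union> (\<lambda>ns. ns @ [Suc N]) ` increasing_lists N r"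
proof -
  have "ns \<in> increasing_lists (Suc N) (Suc r) \<longleftrightarrow>
      ns \<in> increasing_lists N (Suc r) \<or> (\<exists>ms\<in>increasing_lists N r. ns = ms @ [Suc N])" for ns
  proof (cases ns rule: rev_cases)
    case Nil
    thus ?thesis by (simp add: increasing_lists_def)
  next
    case (snoc ms m)
    show ?thesis
      unfolding snoc append_in_increasing_lists_iff by (cases "m = Suc N") auto
  qed
  thus ?thesis by auto
qed

lemma nested_sum_Nil [simp]: "nested_sum a N [] = 1"
  by (simp add: nested_sum_def)

lemma nested_sum_0: "ks \<noteq> [] \<Longrightarrow> nested_sum a 0 ks = 0"
  by (cases ks) (simp_all add: nested_sum_def)

text \<open>
  The new summands are those whose largest entry is $N + 1$, necessarily paired with the last
  exponent.
\<close>

lemma nested_sum_Suc_append: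
  "nested_sum a (Suc N) (ks @ [k]) =
     nested_sum a N (ks @ [k]) + a (Suc N) ^ k * nested_sum a N ks"
proof -
  let ?f = "\<lambda>ns. \<Prod>j<Suc (length ks). a (ns ! j) ^ ((ks @ [k]) ! j)"
  have last: "?f (ns @ [Suc N]) = a (Suc N) ^ k * (\<Prod>j<length ks. a (ns ! j) ^ (ks ! j))"
    if "ns \<in> increasing_lists N (length ks)" for ns
  proof -
    have "length ns = length ks" using that by (simp add: increasing_lists_def)
    hence "(\<Prod>j<length ks. a ((ns @ [Suc N]) ! j) ^ ((ks @ [k]) ! j)) =
        (\<Prod>j<length ks. a (ns ! j) ^ (ks ! j))"
      by (intro prod.cong) (auto simp: nth_append)
    thus ?thesis using \<open>length ns = length ks\<close>
      by (simp add: nth_append mult.commute)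
  qed
  have "nested_sum a (Suc N) (ks @ [k]) = sum ?f (increasing_lists N (Suc (length ks))) +
      sum ?f ((\<lambda>ns. ns @ [Suc N]) ` increasing_lists N (length ks))"
    unfolding nested_sum_def length_append_singleton increasing_lists_Suc_Suc
  proof (intro sum.union_disjoint)
    show "increasing_lists N (Suc (length ks)) \<inter> (\<lambda>ns. ns @ [Suc N]) ` increasing_lists N (length ks) = {}"
      by (auto simp: increasing_lists_def)
  qed auto
  also have "sum ?f ((\<lambda>ns. ns @ [Suc N]) ` increasing_lists N (length ks)) =
      (\<Sum>ns\<in>increasing_lists N (length ks). ?f (ns @ [Suc N]))"
    by (subst sum.reindex) (auto simp: inj_on_def)
  also have "\<dots> = a (Suc N) ^ k * nested_sum a N ks"
    unfolding nested_sum_def sum_distrib_left by (intro sum.cong refl last)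
  finally show ?thesis
    by (simp add: nested_sum_def)
qed

lemma nested_sum_singleton_Suc: "nested_sum a (Suc N) [n] = nested_sum a N [n] + a (Suc N) ^ n"
  using nested_sum_Suc_append[of a N "[]" n] by simp


section \<open>The generating series over all indices\<close>

text \<open>
  The exponents of a monomial determine the index set: the exponent of $y$ is the depth, that
  of $u$ the height, and the weight is the sum of the exponents of $x$ and $y$.
\<close>

definition index_series :: "(nat list \<Rightarrow> 'a::comm_ring_1) \<Rightarrow> 'a fps3" where
  "index_series Z = fps3_of (\<lambda>i j l. \<Sum>ks\<in>indices (i + j) j l. Z ks)"

lemma coeff3_index_series [simp]:
  "coeff3 (index_series Z) i j l = (\<Sum>ks\<in>indices (i + j) j l. Z ks)"
  by (simp add: index_series_def)

lemma height_append: "height (ks @ [k]) = height ks + (if k \<ge> 2 then 1 else 0)"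
proof -
  have "height ks = length (filter (\<lambda>k. k \<ge> 2) ks)" for ks
    by (simp add: height_def length_filter_conv_card)
  thus ?thesis by simp
qed

lemma indices_depth_0: "indices k 0 h = (if k = 0 \<and> h = 0 then {[]} else {})"
  by (auto simp: indices_def weight_def depth_def height_def)

lemma height_le_depth: "height ks \<le> depth ks"
proof -
  have "height ks \<le> card {..<length ks}"
    unfolding height_def by (rule card_mono) auto
  thus ?thesis by (simp add: depth_def)
qed

lemma depth_le_weight: "\<forall>m\<in>set ks. m \<ge> 1 \<Longrightarrow> depth ks \<le> weight ks"
  by (induction ks) (auto simp: depth_def weight_def)

lemma append_in_indices_iff:
  "ks @ [k] \<in> indices w (Suc r) h \<longleftrightarrow>
     1 \<le> k \<and> k \<le> w \<and> (k \<ge> 2 \<longrightarrow> h > 0) \<and> ks \<in> indices (w - k) r (if k \<ge> 2 then h - 1 else h)"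
  by (auto simp: indices_def weight_def depth_def height_append)

text \<open>
  An index is split according to its last entry. Entries at least two also raise the height, so
  they need $l > 0$, and the excess of the weight over the depth leaves room for them only if
  $i > 0$.
\<close>

lemma indices_Suc:
  "indices (i + Suc j) (Suc j) l =
     (\<lambda>ks. ks @ [1]) ` indices (i + j) j l \<union>
     (if i = 0 \<or> l = 0 then {}
      else (\<Union>m\<in>{0..i - 1}. (\<lambda>ks. ks @ [m + 2]) ` indices (i - 1 - m + j) j (l - 1)))"
  (is "?I = ?one \<union> ?big")
proof -
  have weight_ge: "j \<le> w" if "ks \<in> indices w j h" for ks w h
    using that depth_le_weight[of ks] by (auto simp: indices_def)
  have "ks @ [k] \<in> ?I \<longleftrightarrow> k = 1 \<and> ks \<in> indices (i + j) j l \<or>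
      i \<noteq> 0 \<and> l \<noteq> 0 \<and> (\<exists>m\<le>i - 1. k = m + 2 \<and> ks \<in> indices (i - 1 - m + j) j (l - 1))"
    (is "_ \<longleftrightarrow> ?R") for ks k
  proof (cases "k \<ge> 2")
    case False
    thus ?thesis
      unfolding append_in_indices_iff by (cases "k = 1") auto
  next
    case True
    define m where "m = k - 2"
    with True have k: "k = m + 2"
      by simp
    have "ks @ [k] \<in> ?I \<longleftrightarrow> m + 2 \<le> i + Suc j \<and> l > 0 \<and>
        ks \<in> indices (i + Suc j - (m + 2)) j (l - 1)"
      unfolding append_in_indices_iff k by auto
    also have "\<dots> \<longleftrightarrow> i \<noteq> 0 \<and> l \<noteq> 0 \<and> m \<le> i - 1 \<and> ks \<in> indices (i - 1 - m + j) j (l - 1)"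
    proof (cases "i \<noteq> 0 \<and> m \<le> i - 1")
      case True
      have eq: "i + Suc j - (m + 2) = i - 1 - m + j"
        using True by auto
      have "m + 2 \<le> i + Suc j"
        using True by auto
      thus ?thesis
        unfolding eq using True by blast
    next
      case False
      have "\<not> (m + 2 \<le> i + Suc j \<and> ks \<in> indices (i + Suc j - (m + 2)) j (l - 1))"
      proof
        assume *: "m + 2 \<le> i + Suc j \<and> ks \<in> indices (i + Suc j - (m + 2)) j (l - 1)"
        hence "j \<le> i + Suc j - (m + 2)"
          by (intro weight_ge) (rule conjunct2)
        hence "i \<noteq> 0 \<and> m \<le> i - 1"
          using * by linarith
        thus False
          using False by contradiction
      qed
      thus ?thesis
        using False by argo
    qed
    finally show ?thesis
      by (auto simp: k)
  qed
  moreover have "[] \<notin> ?I"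
    by (simp add: indices_def depth_def)
  ultimately have "ns \<in> ?I \<longleftrightarrow> ns \<in> ?one \<union> ?big" for ns
    by (cases ns rule: rev_cases) auto
  thus ?thesis by blast
qed

lemma sum_indices_Suc:
  fixes f :: "nat list \<Rightarrow> 'a::comm_ring_1"
  shows "sum f (indices (i + Suc j) (Suc j) l) = (\<Sum>ks\<in>indices (i + j) j l. f (ks @ [1])) +
     (if i = 0 \<or> l = 0 then 0
      else (\<Sum>m=0..i - 1. \<Sum>ks\<in>indices (i - 1 - m + j) j (l - 1). f (ks @ [m + 2])))"
proof -
  let ?big = "\<Union>m\<in>{0..i - 1}. (\<lambda>ks. ks @ [m + 2]) ` indices (i - 1 - m + j) j (l - 1)"
  have inj: "inj_on (\<lambda>ks. ks @ [k]) A" for k :: nat and A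
    by (simp add: inj_on_def)
  have "sum f ?big = (\<Sum>m=0..i - 1. \<Sum>ks\<in>indices (i - 1 - m + j) j (l - 1). f (ks @ [m + 2]))"
    by (subst sum.UNION_disjoint)
       (auto simp: finite_indices sum.reindex[OF inj] simp del: One_nat_def add_2_eq_Suc')
  moreover have "sum f (indices (i + Suc j) (Suc j) l) =
      sum f ((\<lambda>ks. ks @ [1]) ` indices (i + j) j l) + sum f (if i = 0 \<or> l = 0 then {} else ?big)"
    unfolding indices_Suc by (rule sum.union_disjoint) (auto simp: finite_indices)
  ultimately show ?thesis
    by (simp add: sum.reindex[OF inj])
qed

text \<open>
  The factor that a single element $a$ contributes to the generating series: the sum over $m$ is
  the geometric series $1/(1 - a x)$, and it collects the exponents $m + 2 \ge 2$.
\<close>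

definition depth_factor :: "'a::comm_ring_1 \<Rightarrow> 'a fps3" where
  "depth_factor a = 1 + const3 a * vary +
     (const3 a)\<^sup>2 * varx * vary * varu * fps_const (fps_const (Abs_fps (\<lambda>m. a ^ m)))"

lemma depth_factor_mult: "depth_factor a * linear_factor a = quadratic_factor a"
proof -
  define h where "h = Abs_fps (\<lambda>m. a ^ m)"
  define H where "H = fps_const (fps_const h)"
  have "h - fps_const a * (fps_X * h) = 1"
    by (rule fps_ext) (auto simp: h_def power_eq_if)
  hence "h * (1 - fps_const a * fps_X) = 1"
    by (simp add: algebra_simps)
  moreover have "linear_factor a = fps_const (fps_const (1 - fps_const a * fps_X))"
    by (simp add: linear_factor_def const3_def varx_def flip: fps_const_sub)
  ultimately have "H * linear_factor a = 1"
    by (simp add: H_def)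
  hence "depth_factor a * linear_factor a =
      (1 + const3 a * vary) * linear_factor a + (const3 a)\<^sup>2 * varx * vary * varu"
    by (simp add: depth_factor_def H_def[symmetric] h_def[symmetric] distrib_right mult.assoc)
  thus ?thesis
    by (simp add: linear_factor_def quadratic_factor_def \<sigma>_def \<pi>_def algebra_simps power2_eq_square)
qed

lemma index_series_Suc:
  "index_series (nested_sum a (Suc N)) = index_series (nested_sum a N) * depth_factor (a (Suc N))"
proof (rule fps3_eqI)
  fix i j l
  define c where "c = a (Suc N)"
  define L where "L = index_series (nested_sum a N)"
  define H where "H = Abs_fps (\<lambda>m. c ^ m)"
  \<comment> \<open>The variables are moved to the left, where they act on coefficients as shifts.\<close>
  have eq: "L * depth_factor c = L + const3 c * (vary * L) +
      const3 (c ^ 2) * (varx * (vary * (varu * (fps_const (fps_const H) * L))))"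
    by (simp add: depth_factor_def H_def const3_power algebra_simps)
  show "coeff3 (index_series (nested_sum a (Suc N))) i j l =
      coeff3 (index_series (nested_sum a N) * depth_factor (a (Suc N))) i j l"
  proof (cases j)
    case 0
    thus ?thesis
      unfolding c_def[symmetric] L_def[symmetric] eq by (simp add: L_def indices_depth_0)
  next
    case (Suc j')
    have split: "(\<Sum>ks\<in>A. nested_sum a (Suc N) (ks @ [k])) =
        (\<Sum>ks\<in>A. nested_sum a N (ks @ [k])) + c ^ k * (\<Sum>ks\<in>A. nested_sum a N ks)" for A k
      by (simp add: nested_sum_Suc_append c_def sum.distrib sum_distrib_left)
    show ?thesis
      unfolding c_def[symmetric] L_def[symmetric] eq unfolding Suc
      by (simp add: L_def sum_indices_Suc split coeff3_series_in_x_mult H_def sum.distrib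
          sum_distrib_left power_add mult.assoc mult.left_commute power2_eq_square
          del: One_nat_def add_2_eq_Suc' add_Suc_right)
  qed
qed

text \<open>
  Passing from $N$ to $N + 1$ multiplies the generating series by $B / A$ and adds the logarithmic
  derivative of $B / A$ to the other factor. Both $A$ and $B$ have constant term 1, so they are
  nonzero and may be cancelled over an integral domain.
\<close>

lemma euler3_index_series_nested_sum:
  fixes a :: "nat \<Rightarrow> 'a::idom"
  shows "euler3 (index_series (nested_sum a N)) =
     index_series (nested_sum a N) * power_sum_series (\<lambda>n. nested_sum a N [n])"
proof (induction N)
  case 0
  have "index_series (nested_sum a 0) = 1"
  proof (rule fps3_eqI)
    fix i j l
    show "coeff3 (index_series (nested_sum a 0)) i j l = coeff3 1 i j l"
    proof (cases j)
      case (Suc j')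
      have "nested_sum a 0 ks = 0" if "ks \<in> indices (i + j) j l" for ks
        using that by (intro nested_sum_0) (auto simp: Suc indices_def depth_def)
      thus ?thesis by (simp add: Suc)
    qed (simp add: indices_depth_0)
  qed
  moreover have "power_sum_series (\<lambda>n. nested_sum a 0 [n]) = 0"
    by (rule fps3_eqI) (simp add: coeff3_power_sum_series nested_sum_0)
  ultimately show ?case by simp
next
  case (Suc N)
  define c where "c = a (Suc N)"
  define A where "A = linear_factor c"
  define B where "B = quadratic_factor c"
  define L where "L = index_series (nested_sum a N)"
  define L' where "L' = index_series (nested_sum a (Suc N))"
  define T where "T = power_sum_series (\<lambda>n. nested_sum a N [n])"
  define T1 where "T1 = power_sum_series (\<lambda>n. c ^ n)"
  have step: "L' * A = L * B"
    unfolding L'_def L_def A_def B_def c_def index_series_Suc mult.assoc depth_factor_mult ..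
  have T1: "A * B * T1 = A * euler3 B - B * euler3 A"
    unfolding A_def B_def T1_def by (rule power_sum_series_geometric)
  have IH: "euler3 L = L * T"
    using Suc by (simp add: L_def T_def)
  have "euler3 L' * A = L * T * B + L * euler3 B - L' * euler3 A"
    using arg_cong[OF step, of euler3] by (simp add: euler3_mult IH eq_diff_eq)
  hence "B * (euler3 L' * A) = B * (L * T * B + L * euler3 B - L' * euler3 A)"
    by (rule arg_cong)
  hence "(A * B) * euler3 L' = B * (L * B) * T + (L * B) * euler3 B - B * L' * euler3 A"
    by (simp add: algebra_simps)
  also have "\<dots> = (A * B) * (L' * T) + L' * (A * euler3 B - B * euler3 A)"
    unfolding step[symmetric] by (simp add: algebra_simps)
  also have "\<dots> = (A * B) * (L' * (T + T1))"
    unfolding T1[symmetric] by (simp add: algebra_simps)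
  finally have "(A * B) * euler3 L' = (A * B) * (L' * (T + T1))" .
  moreover have "coeff3 A 0 0 0 = 1" "coeff3 B 0 0 0 = 1"
    by (simp_all add: A_def B_def linear_factor_def quadratic_factor_def \<sigma>_def \<pi>_def
        mult.assoc flip: const3_power)
  hence "A \<noteq> 0" "B \<noteq> 0"
    by auto
  ultimately have "euler3 L' = L' * (T + T1)"
    by simp
  moreover have "power_sum_series (\<lambda>n. nested_sum a (Suc N) [n]) = T + T1"
    unfolding nested_sum_singleton_Suc power_sum_series_add T_def T1_def c_def ..
  ultimately show ?case
    by (simp add: L'_def)
qed


section \<open>Naturality under ring homomorphisms\<close>

text \<open>
  The differential equation is compatible with ring homomorphisms. It is carried from the integers
  to $\mathcal A$ through the ring of families $\mathbb{N} \to \mathbb{Z}$, which maps to the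
  integers by evaluation at $p$, jointly injectively, and to $\mathcal A$ by the quotient map.
\<close>

locale comm_ring_morphism =
  fixes \<phi> :: "'a::comm_ring_1 \<Rightarrow> 'b::comm_ring_1"
  assumes map_1 [simp]: "\<phi> 1 = 1"
    and map_add [simp]: "\<phi> (a + b) = \<phi> a + \<phi> b"
    and map_mult [simp]: "\<phi> (a * b) = \<phi> a * \<phi> b"
begin

lemma map_0 [simp]: "\<phi> 0 = 0"
  using map_add[of 0 0] by simp

lemma map_diff [simp]: "\<phi> (a - b) = \<phi> a - \<phi> b"
  using map_add[of "a - b" b] by (simp add: algebra_simps)

lemma map_sum [simp]: "\<phi> (sum f A) = (\<Sum>x\<in>A. \<phi> (f x))"
  by (induction A rule: infinite_finite_induct) auto

lemma map_of_nat [simp]: "\<phi> (of_nat n) = of_nat n"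
  by (induction n) auto

definition map3 :: "'a fps3 \<Rightarrow> 'b fps3" where
  "map3 F = fps3_of (\<lambda>i j l. \<phi> (coeff3 F i j l))"

lemma coeff3_map3 [simp]: "coeff3 (map3 F) i j l = \<phi> (coeff3 F i j l)"
  by (simp add: map3_def)

lemma map3_mult: "map3 (F * G) = map3 F * map3 G"
  by (rule fps3_eqI) (simp add: coeff3_mult)

lemma map3_add: "map3 (F + G) = map3 F + map3 G"
  by (rule fps3_eqI) simp

lemma map3_diff: "map3 (F - G) = map3 F - map3 G"
  by (rule fps3_eqI) simp

lemma map3_0: "map3 0 = 0"
  by (rule fps3_eqI) simp

lemma map3_1: "map3 1 = 1"
  by (rule fps3_eqI) simp

lemma map3_varx: "map3 varx = varx"
  by (rule fps3_eqI) simp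

lemma map3_vary: "map3 vary = vary"
  by (rule fps3_eqI) simp

lemma map3_varu: "map3 varu = varu"
  by (rule fps3_eqI) simp

lemma map3_power: "map3 (F ^ n) = map3 F ^ n"
  by (induction n) (simp_all add: map3_1 map3_mult)

lemma map3_power_sum2: "map3 (power_sum2 n s t) = power_sum2 n (map3 s) (map3 t)"
proof (induction n s t rule: power_sum2.induct)
  case (1 s t)
  have "map3 (1 + 1) = 1 + 1"
    by (simp only: map3_add map3_1)
  thus ?case
    by (simp only: power_sum2.simps one_add_one)
qed (simp_all add: map3_mult map3_diff)

lemma map3_power_sum_diff: "map3 (power_sum_diff n) = power_sum_diff n"
proof -
  have "map3 \<sigma> = \<sigma>"
    by (simp add: \<sigma>_def map3_diff map3_varx map3_vary)
  moreover have "map3 (0 - varx * vary * (1 - varu)) = 0 - varx * vary * (1 - varu)"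
    by (simp only: map3_diff map3_mult map3_0 map3_1 map3_varx map3_vary map3_varu)
  hence "map3 \<pi> = \<pi>"
    by (simp add: \<pi>_def)
  ultimately show ?thesis
    by (simp add: power_sum_diff_def map3_diff map3_power map3_varx map3_power_sum2)
qed

lemma map3_power_sum_series: "map3 (power_sum_series z) = power_sum_series (\<lambda>n. \<phi> (z n))"
proof (rule fps3_eqI)
  fix i j l
  have "\<phi> (coeff3 (power_sum_diff n) i j l) = coeff3 (power_sum_diff n) i j l" for n
    by (subst map3_power_sum_diff[symmetric]) simp
  thus "coeff3 (map3 (power_sum_series z)) i j l = coeff3 (power_sum_series (\<lambda>n. \<phi> (z n))) i j l"
    by (simp add: coeff3_power_sum_series)
qed

lemma map3_index_series: "map3 (index_series Z) = index_series (\<lambda>ks. \<phi> (Z ks))"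
  by (rule fps3_eqI) simp

lemma map3_euler3: "map3 (euler3 F) = euler3 (map3 F)"
  by (rule fps3_eqI) (simp del: of_nat_add)

end

lemma comm_ring_morphism_eval: "comm_ring_morphism (\<lambda>f :: 'i \<Rightarrow> 'a::comm_ring_1. f p)"
  by unfold_locales auto

lemma comm_ring_morphism_abs_padele: "comm_ring_morphism abs_padele"
  by unfold_locales
     (simp_all add: one_padele.abs_eq plus_padele.abs_eq times_padele.abs_eq
       one_fun_def plus_fun_def times_fun_def)


section \<open>The values in the ring of finite adeles\<close>

text \<open>
  A representative of the zeta value in which powers of inverses take the place of inverses of
  powers. The two agree only modulo $p$, but with this one the components are nested
  sums on the nose, so that identities between nested sums hold exactly in $\mathbb{Z}$.
\<close>

definition zeta2_family :: "nat list \<Rightarrow> nat \<Rightarrow> int" where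
  "zeta2_family ks p = nested_sum (\<lambda>n. modular_inverse (int p) (int n)) ((p - 1) div 2) ks"

lemma modular_inverse_power_cong:
  fixes a m :: int
  assumes "coprime a m"
  shows "[modular_inverse m (a ^ k) = modular_inverse m a ^ k] (mod m)"
proof -
  have 1: "[a ^ k * modular_inverse m (a ^ k) = 1] (mod m)"
    by (intro cong_modular_inverse1) (use assms in simp)
  have "[(a * modular_inverse m a) ^ k = 1 ^ k] (mod m)"
    by (intro cong_pow cong_modular_inverse1 assms)
  hence "[a ^ k * modular_inverse m a ^ k = 1] (mod m)"
    by (simp add: power_mult_distrib)
  hence "[a ^ k * modular_inverse m (a ^ k) = a ^ k * modular_inverse m a ^ k] (mod m)"
    by (intro cong_trans[OF 1 cong_sym])
  moreover have "coprime (a ^ k) m"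
    using assms by simp
  ultimately show ?thesis
    using cong_mult_lcancel by blast
qed

lemma zeta2_eq: "zeta2 ks = abs_padele (zeta2_family ks)"
proof -
  have "[zeta2_sum ks p = zeta2_family ks p] (mod int p)" if p: "prime p" for p
  proof -
    have set_eq: "{ns. length ns = length ks \<and> sorted_wrt (<) ns \<and> (\<forall>n\<in>set ns. 0 < n \<and> 2 * n < p)} =
        increasing_lists ((p - 1) div 2) (length ks)"
    proof -
      have "0 < n \<and> 2 * n < p \<longleftrightarrow> n \<in> {1..(p - 1) div 2}" for n
        by auto
      hence "(\<forall>n\<in>set ns. 0 < n \<and> 2 * n < p) \<longleftrightarrow> set ns \<subseteq> {1..(p - 1) div 2}" for ns
        by blast
      thus ?thesis
        by (simp only: increasing_lists_def)
    qed
    have coprime: "coprime (int (ns ! j)) (int p)"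
      if "ns \<in> increasing_lists ((p - 1) div 2) (length ks)" "j < length ks" for ns j
    proof -
      have "ns ! j \<in> set ns" "set ns \<subseteq> {1..(p - 1) div 2}"
        using that by (auto simp: increasing_lists_def)
      hence "ns ! j \<in> {1..(p - 1) div 2}"
        by blast
      hence "0 < ns ! j" "ns ! j < p"
        by auto
      hence "\<not> p dvd ns ! j"
        by (auto dest: dvd_imp_le)
      thus ?thesis
        using p by (simp add: coprime_commute prime_imp_coprime)
    qed
    show ?thesis
      unfolding zeta2_sum_def set_eq zeta2_family_def nested_sum_def
      by (rule cong_sum, rule cong_prod, rule modular_inverse_power_cong, rule coprime) simp_all
  qed
  hence "{p. prime p \<and> \<not> [zeta2_sum ks p = zeta2_family ks p] (mod int p)} = {}"
    by blast
  hence "padele_rel (zeta2_sum ks) (zeta2_family ks)"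
    by (simp only: padele_rel_def finite.emptyI)
  thus ?thesis
    by (simp add: zeta2_def padele.abs_eq_iff)
qed

lemma euler3_index_series_zeta2:
  "euler3 (index_series zeta2) = index_series zeta2 * power_sum_series (\<lambda>n. zeta2 [n])"
proof -
  interpret abs: comm_ring_morphism abs_padele
    by (rule comm_ring_morphism_abs_padele)
  define X where "X = euler3 (index_series zeta2_family) -
      index_series zeta2_family * power_sum_series (\<lambda>n. zeta2_family [n])"
  have "X = 0"
  proof (rule fps3_eqI, rule ext)
    fix i j l p
    interpret ev: comm_ring_morphism "\<lambda>f :: nat \<Rightarrow> int. f p"
      by (rule comm_ring_morphism_eval)
    have "ev.map3 X = 0"
      unfolding X_def ev.map3_diff ev.map3_mult ev.map3_euler3 ev.map3_index_series
        ev.map3_power_sum_series zeta2_family_def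
      using euler3_index_series_nested_sum by simp
    from arg_cong[OF this, of "\<lambda>F. coeff3 F i j l"]
    show "coeff3 X i j l p = coeff3 0 i j l p"
      by simp
  qed
  hence "abs.map3 X = 0"
    by (simp add: abs.map3_0)
  thus ?thesis
    by (simp add: X_def abs.map3_diff abs.map3_mult abs.map3_euler3 abs.map3_index_series
        abs.map3_power_sum_series flip: zeta2_eq)
qed

lemma zeta2_Nil: "zeta2 [] = 1"
proof -
  have "zeta2_family [] = (\<lambda>_. 1)"
    by (simp add: zeta2_family_def fun_eq_iff)
  thus ?thesis
    by (simp add: zeta2_eq one_padele.abs_eq)
qed

lemma padele_of_nat_divide:
  assumes "n > 0"
  shows "of_nat n * (a / of_nat n) = (a :: padele)"
  using padele_of_nat_inverse[OF assms] by (simp add: divide_padele_def mult.left_commute)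

text \<open>
  The summand 1 on the left accounts for the empty index, the only one of depth zero. Heights
  above the depth contribute nothing on the right because there are no such indices.
\<close>

lemma generating_series_eq_index_series:
  "1 + formal_sum3
         (\<lambda>(k, r, h). const3 (S2 k r h) * varx ^ (k - r) * vary ^ r * varu ^ h)
         {(k, r, h). k \<ge> r \<and> r \<ge> 1 \<and> h \<le> r} = index_series zeta2"
    (is "1 + formal_sum3 ?f ?I = _")
proof (rule fps3_eqI)
  fix i j l
  have coeff: "coeff3 (?f s) i j l = (if s = (i + j, j, l) then S2 (i + j) j l else 0)"
    if "s \<in> ?I" for s
    using that by (auto simp: coeff3_monomial split: if_splits)
  have "coeff3 (formal_sum3 ?f ?I) i j l = (if j \<ge> 1 \<and> l \<le> j then S2 (i + j) j l else 0)"
  proof (cases "j \<ge> 1 \<and> l \<le> j")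
    case True
    have "coeff3 (formal_sum3 ?f ?I) i j l = (\<Sum>s\<in>{(i + j, j, l)}. coeff3 (?f s) i j l)"
      unfolding coeff3_formal_sum3
      by (rule sum.mono_neutral_left) (use True coeff in \<open>auto split: if_splits\<close>)
    thus ?thesis
      using True coeff[of "(i + j, j, l)"] by simp
  next
    case False
    hence "coeff3 (?f s) i j l = 0" if "s \<in> ?I" for s
      using coeff[OF that] that by auto
    thus ?thesis
      using False unfolding coeff3_formal_sum3 by (auto intro!: sum.neutral)
  qed
  moreover have "S2 (i + j) j l = 0" if "l > j"
  proof -
    have "ks \<notin> indices (i + j) j l" for ks
      using that height_le_depth[of ks] by (auto simp: indices_def)
    thus ?thesis
      unfolding S2_def by (intro sum.neutral) blast
  qed
  moreover have "S2 (i + j) j l = (if i = 0 \<and> l = 0 then 1 else 0)" if "j = 0"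
    using that by (simp add: S2_def indices_depth_0 zeta2_Nil)
  ultimately show "coeff3 (1 + formal_sum3 ?f ?I) i j l = coeff3 (index_series zeta2) i j l"
    by (cases "j = 0") (auto simp: S2_def[symmetric])
qed

theorem theorem1p2:
  shows "1 + formal_sum3
           (\<lambda>(k, r, h). const3 (S2 k r h) * varx ^ (k - r) * vary ^ r * varu ^ h)
           {(k, r, h). k \<ge> r \<and> r \<ge> 1 \<and> h \<le> r}
       = formal_exp3 (formal_sum3
           (\<lambda>n. const3 (zeta2 [n] / of_nat n) *
                 (varx ^ n - power_sum2 n (varx - vary) (- (varx * vary * (1 - varu)))))
           {1..})"
proof -
  define F where "F = power_sum_series (\<lambda>n. zeta2 [n] / of_nat n)"
  have F: "euler3 F = power_sum_series (\<lambda>n. zeta2 [n])"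
    unfolding F_def by (rule euler3_power_sum_series) (rule padele_of_nat_divide)
  have F00: "coeff3 F 0 0 l = 0" for l
  proof -
    have "coeff3 (power_sum_diff n) 0 0 l = (0::padele)" if "n > 0" for n
    proof -
      have "of_nat n * coeff3 (power_sum_diff n) 0 0 l = (0 :: padele)"
        using arg_cong[OF euler3_power_sum_diff[OF that], of "\<lambda>F. coeff3 F 0 0 l"] by simp
      thus ?thesis
        by (metis padele_of_nat_inverse[OF that] mult.assoc mult.commute mult_1 mult_zero_right)
    qed
    thus ?thesis
      by (simp add: F_def coeff3_power_sum_series)
  qed
  have "index_series zeta2 = formal_exp3 F"
  proof (rule euler3_equation_unique)
    show "c = 0" if "n > 0" "of_nat n * c = 0" for n and c :: padele
      using that by (metis padele_of_nat_inverse mult.assoc mult.commute mult_1 mult_zero_right)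
    show "coeff3 (euler3 F) 0 0 l = 0" for l
      by simp
    show "euler3 (index_series zeta2) = index_series zeta2 * euler3 F"
      unfolding F by (rule euler3_index_series_zeta2)
    show "euler3 (formal_exp3 F) = formal_exp3 F * euler3 F"
      using padele_of_nat_divide F00 by (rule euler3_formal_exp3)
    show "coeff3 (index_series zeta2) 0 0 l = coeff3 (formal_exp3 F) 0 0 l" for l
      by (subst coeff3_formal_exp3_00)
         (simp_all add: padele_of_nat_divide F00 indices_depth_0 zeta2_Nil)
  qed
  thus ?thesis
    unfolding generating_series_eq_index_series F_def power_sum_series_def power_sum_diff_def \<sigma>_def \<pi>_def .
qed

end
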